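(* Let $U$ be a Hopf set which is a finite union of intervals. Then $U$ can be extended to a maximal Hopf set, i.e., there exists a maximal Hopf set $\widetilde{U}$ with $U\subset\widetilde{U}$.
   Context: A set $U$ of real numbers is additive if $a+b\in U$ for all $a,b\in U$. A Hopf set is a set $U\subset\mathbb{R}$ which is open, additive and of the form $U=V\cup(1,\infty)$ with $V\subset(0,1)$. If in addition $m(V)=\frac{1}{2}$, where $m$ denotes Lebesgue measure, then $U$ is called a maximal Hopf set. *)

theory Defs
  imports "HOL-Analysis.Analysis"
begin

definition additive_set :: "real set \<Rightarrow> bool" where
  "additive_set U \<longleftrightarrow> (\<forall>a\<in>U. \<forall>b\<in>U. a + b \<in> U)"

definition hopf_set :: "real set \<Rightarrow> bool" where
  "hopf_set U \<longleftrightarrow> open U \<and> additive_set U \<and> (\<exists>V. V \<subseteq> {0<..<1} \<and> U = V \<union> {1<..})"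

text \<open>The set \<open>V\<close> is unique (it is \<open>U \<inter> {0<..<1}\<close>), and it is open when \<open>U\<close> is, hence measurable.\<close>

definition maximal_hopf_set :: "real set \<Rightarrow> bool" where
  "maximal_hopf_set U \<longleftrightarrow> hopf_set U \<and>
     (\<exists>V. V \<subseteq> {0<..<1} \<and> U = V \<union> {1<..} \<and> measure lebesgue V = 1 / 2)"

definition finite_union_of_intervals :: "real set \<Rightarrow> bool" where
  "finite_union_of_intervals U \<longleftrightarrow>
     (\<exists>\<I>. finite \<I> \<and> (\<forall>I\<in>\<I>. is_interval I) \<and> U = \<Union>\<I>)"

end

theory Submission
  imports Defs
begin

text \<open>
  The argument is the one that embeds a numerical semigroup with Frobenius number \<open>F\<close> into a
  symmetric or pseudo-symmetric one, with \<open>1\<close> in the role of \<open>F\<close>. As \<open>1\<close> is not in the Hopf set \<open>U\<close>,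
  at most one of \<open>x\<close> and \<open>1 - x\<close> lies in \<open>U\<close>, and \<open>U\<close> is maximal when almost every such pair has
  a member in \<open>U\<close>. For the pairs that \<open>U\<close> misses, one adjoins the larger member. This
  gives the set \<open>symmetrization U\<close>, and it is still additive: two
  adjoined points have sum greater than \<open>1\<close>, and if \<open>x\<close> is adjoined, \<open>s \<in> U\<close> and
  \<open>x + s < 1\<close>, then \<open>1 - (x + s) \<in> U\<close> is impossible, because adding \<open>s\<close> would give \<open>1 - x \<in> U\<close>.

  The symmetrization need not be open, but the interior of an additive set is additive, so the
  interior of the symmetrization is again a Hopf set. Apart from the midpoint, passing to the
  interior loses only pairs that meet the frontier of \<open>U\<close>. Hence every Hopf set with negligible frontier extends to a maximal one, and a
  finite union of intervals has finite, in particular negligible, frontier.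
\<close>

lemma hopf_set_alt:
  "hopf_set U \<longleftrightarrow> open U \<and> additive_set U \<and> {1<..} \<subseteq> U \<and> U \<subseteq> {0<..} - {1}"
proof
  assume "hopf_set U"
  then show "open U \<and> additive_set U \<and> {1<..} \<subseteq> U \<and> U \<subseteq> {0<..} - {1}"
    unfolding hopf_set_def by force
next
  assume R: "open U \<and> additive_set U \<and> {1<..} \<subseteq> U \<and> U \<subseteq> {0<..} - {1}"
  then have "U = (U \<inter> {0<..<1}) \<union> {1<..}"
    by fastforce
  with R show "hopf_set U"
    unfolding hopf_set_def by blast
qed

text \<open>If \<open>b \<in> A\<close>, translation by \<open>b\<close> carries a neighbourhood of \<open>a\<close> within \<open>A\<close> to one of \<open>a + b\<close>.\<close>
lemma additive_set_interior:
  assumes "additive_set A"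
  shows "additive_set (interior A)"
  unfolding additive_set_def
proof (intro ballI)
  fix a b assume a: "a \<in> interior A" and b: "b \<in> interior A"
  have "open ((\<lambda>x. x + b) ` interior A)"
    using open_translation[OF open_interior, of b A] by (simp add: add.commute)
  moreover have "(\<lambda>x. x + b) ` interior A \<subseteq> A"
    using assms b interior_subset unfolding additive_set_def by blast
  ultimately show "a + b \<in> interior A"
    using a by (meson image_eqI interior_maximal subsetD)
qed

text \<open>
  If \<open>U\<close> is a Hopf set, then \<open>1 - x \<notin> U\<close> also holds for every \<open>x \<in> U\<close>. So the second part consists
  of the points of \<open>U\<close> in \<open>{1/2<..<1}\<close> and of the larger members of the pairs \<open>{x, 1 - x}\<close>
  that \<open>U\<close> misses.
\<close>
definition symmetrization :: "real set \<Rightarrow> real set" where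
  "symmetrization U = U \<union> {x. 1/2 < x \<and> x < 1 \<and> 1 - x \<notin> U}"

lemma additive_set_symmetrization:
  assumes "hopf_set U"
  shows "additive_set (symmetrization U)"
proof -
  let ?N = "{x. 1/2 < x \<and> x < 1 \<and> 1 - x \<notin> U}"
  have add: "a + b \<in> U" if "a \<in> U" "b \<in> U" for a b
    using assms that unfolding hopf_set_def additive_set_def by blast
  have pos: "s > 0" if "s \<in> U" for s
    using assms that hopf_set_alt by auto
  have large: "x \<in> U" if "x > 1" for x
    using assms that hopf_set_alt by auto
  have mixed: "x + s \<in> symmetrization U" if x: "x \<in> ?N" and s: "s \<in> U" for x s
  proof -
    have "x + s \<noteq> 1"
    proof
      assume "x + s = 1"
      then have "1 - x = s" by simp
      with x s show False by simp
    qed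
    moreover have "1 - (x + s) \<notin> U"
    proof
      assume "1 - (x + s) \<in> U"
      then have "1 - (x + s) + s \<in> U" using s by (rule add)
      with x show False by simp
    qed
    ultimately show ?thesis
      using x pos[OF s] large[of "x + s"] unfolding symmetrization_def by force
  qed
  show ?thesis
    unfolding additive_set_def
  proof (intro ballI)
    fix a b assume "a \<in> symmetrization U" "b \<in> symmetrization U"
    then consider "a \<in> U" "b \<in> U" | "a \<in> ?N" "b \<in> U" | "a \<in> U" "b \<in> ?N" | "a \<in> ?N" "b \<in> ?N"
      unfolding symmetrization_def by blast
    then show "a + b \<in> symmetrization U"
    proof cases
      case 1
      then show ?thesis using add unfolding symmetrization_def by blast
    next
      case 2
      then show ?thesis by (rule mixed)
    next
      case 3
      then show ?thesis using mixed[of b a] by (simp add: add.commute)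
    next
      case 4
      then have "a + b > 1" by simp
      then show ?thesis using large unfolding symmetrization_def by blast
    qed
  qed
qed

lemma hopf_set_interior_symmetrization:
  assumes "hopf_set U"
  shows "hopf_set (interior (symmetrization U))" and "U \<subseteq> interior (symmetrization U)"
proof -
  have U: "open U" "{1<..} \<subseteq> U" "U \<subseteq> {0<..} - {1}"
    using assms hopf_set_alt by auto
  have "U \<subseteq> symmetrization U"
    unfolding symmetrization_def by blast
  then show sub: "U \<subseteq> interior (symmetrization U)"
    using U(1) by (rule interior_maximal)
  have "interior (symmetrization U) \<subseteq> {0<..} - {1}"
    using interior_subset U(3) unfolding symmetrization_def by force
  then show "hopf_set (interior (symmetrization U))"
    unfolding hopf_set_alt
    using additive_set_interior[OF additive_set_symmetrization[OF assms]] sub U(2)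
      open_interior by blast
qed

text \<open>
  A number \<open>x < 1/2\<close> that lies in \<open>U\<close> is in the interior of the symmetrization because \<open>U\<close> is open,
  and if \<open>x\<close> lies outside the closure of \<open>U\<close>, then the reflections of all points near \<open>x\<close> belong
  to the symmetrization. So only the midpoint and the frontier of \<open>U\<close> can cause a pair to be missed.
\<close>
lemma pairs_missed_by_interior_symmetrization:
  assumes "open U" and "0 < x" and "x < 1/2"
    and "x \<notin> interior (symmetrization U)" and "1 - x \<notin> interior (symmetrization U)"
  shows "x \<in> frontier U"
proof -
  have "U \<subseteq> interior (symmetrization U)"
    using assms(1) by (intro interior_maximal) (auto simp: symmetrization_def)
  with assms(4) have "x \<notin> U" by blast
  moreover have "x \<in> closure U"
  proof (rule ccontr)
    assume x: "x \<notin> closure U"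
    let ?W = "{1/2<..<1} \<inter> (\<lambda>y. 1 - y) -` (- closure U)"
    have "open ?W"
      by (intro open_Int open_vimage continuous_intros) auto
    moreover have "?W \<subseteq> symmetrization U"
      using closure_subset unfolding symmetrization_def by fastforce
    moreover have "1 - x \<in> ?W"
      using x assms(2,3) by simp
    ultimately show False
      using assms(5) by (meson interior_maximal subsetD)
  qed
  ultimately show ?thesis
    using assms(1) by (simp add: frontier_def interior_open)
qed

lemma measure_reflection: "measure lebesgue ((\<lambda>x. 1 - x) ` V) = measure lebesgue V" for V :: "real set"
  using measure_lebesgue_affine[of "-1" 1 V] by simp

lemma negligible_reflection:
  fixes S :: "real set"
  assumes "negligible S"
  shows "negligible ((\<lambda>x. 1 - x) ` S)"
  by (intro negligible_differentiable_image_negligible assms derivative_intros) auto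

text \<open>\<open>V\<close> and its reflection have equal measure and tile the unit interval up to a null set.\<close>
lemma measure_eq_half_if_reflection_complementary:
  fixes V :: "real set"
  assumes "open V" and "V \<subseteq> {0<..<1}" and "V \<inter> (\<lambda>x. 1 - x) ` V = {}"
    and "negligible ({0<..<1} - (V \<union> (\<lambda>x. 1 - x) ` V))"
  shows "measure lebesgue V = 1/2"
proof -
  let ?R = "(\<lambda>x. 1 - x) ` V"
  have "open ?R"
    using open_translation[OF open_negations[OF assms(1)], of 1] by (simp add: image_image)
  have R: "?R \<subseteq> {0<..<1}"
    using assms(2) by auto
  have meas: "V \<in> lmeasurable" "?R \<in> lmeasurable"
    using assms(1,2) \<open>open ?R\<close> R bounded_subset[of "{0<..<1::real}"]
    by (auto intro: lmeasurable_open)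
  have "V \<union> ?R - {0<..<1} = {}"
    using assms(2) R by blast
  with assms(4) have "measure lebesgue (V \<union> ?R) = measure lebesgue {0<..<1::real}"
    by (intro measure_negligible_symdiff) auto
  also have "measure lebesgue (V \<union> ?R) = measure lebesgue V + measure lebesgue ?R"
    using meas assms(3) by (intro measure_Un2[THEN trans]) (auto simp: Diff_triv Int_commute)
  finally show ?thesis
    by (simp add: measure_reflection)
qed

proposition hopf_set_negligible_frontier_extends_to_maximal:
  assumes "hopf_set U" and "negligible (frontier U)"
  shows "maximal_hopf_set (interior (symmetrization U))"
proof -
  define U' where "U' = interior (symmetrization U)"
  define V where "V = U' \<inter> {0<..<1}"
  let ?R = "(\<lambda>x. 1 - x) ` V"
  have "open U" using assms(1) unfolding hopf_set_def by blast
  have hopf: "hopf_set U'"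
    unfolding U'_def using assms(1) by (rule hopf_set_interior_symmetrization)
  then have U': "open U'" "additive_set U'" "{1<..} \<subseteq> U'" "U' \<subseteq> {0<..} - {1}"
    using hopf_set_alt by auto
  have "V \<inter> ?R = {}"
  proof -
    have False if "x \<in> U'" "1 - x \<in> U'" for x
    proof -
      have "x + (1 - x) \<in> U'" using U'(2) that unfolding additive_set_def by blast
      with U'(4) show False by auto
    qed
    then show ?thesis unfolding V_def by auto
  qed
  moreover have "negligible ({0<..<1} - (V \<union> ?R))"
  proof (rule negligible_subset)
    show "negligible ({1/2} \<union> frontier U \<union> (\<lambda>x. 1 - x) ` frontier U)"
      using assms(2) negligible_reflection by auto
    show "{0<..<1} - (V \<union> ?R) \<subseteq> {1/2} \<union> frontier U \<union> (\<lambda>x. 1 - x) ` frontier U"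
    proof
      fix x assume x: "x \<in> {0<..<1} - (V \<union> ?R)"
      then have "x \<notin> U'"
        unfolding V_def by blast
      moreover have "1 - x \<notin> U'"
      proof
        assume "1 - x \<in> U'"
        with x have "1 - x \<in> V" by (simp add: V_def)
        then have "1 - (1 - x) \<in> ?R" by (rule imageI)
        with x show False by simp
      qed
      ultimately have "x \<in> frontier U" if "x < 1/2"
        using pairs_missed_by_interior_symmetrization[of U x] that x \<open>open U\<close>
        by (simp add: U'_def)
      moreover have "1 - x \<in> frontier U" if "x > 1/2"
        using pairs_missed_by_interior_symmetrization[of U "1 - x"] that x \<open>open U\<close>
          \<open>x \<notin> U'\<close> \<open>1 - x \<notin> U'\<close> by (simp add: U'_def)
      then have "x \<in> (\<lambda>x. 1 - x) ` frontier U" if "x > 1/2"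
        using that by (intro image_eqI[of _ _ "1 - x"]) auto
      ultimately show "x \<in> {1/2} \<union> frontier U \<union> (\<lambda>x. 1 - x) ` frontier U"
        by (cases x "1/2 :: real" rule: linorder_cases) auto
    qed
  qed
  ultimately have "measure lebesgue V = 1/2"
    using U'(1) by (intro measure_eq_half_if_reflection_complementary) (auto simp: V_def)
  moreover have "U' = V \<union> {1<..}"
    using U'(3,4) unfolding V_def by fastforce
  moreover have "V \<subseteq> {0<..<1}"
    unfolding V_def by blast
  ultimately have "maximal_hopf_set U'"
    using hopf unfolding maximal_hopf_set_def by blast
  then show ?thesis unfolding U'_def .
qed

lemma negligible_frontier_finite_union_of_intervals:
  assumes "finite_union_of_intervals U"
  shows "negligible (frontier U)"
proof -
  obtain \<I> where I: "finite \<I>" "\<And>I. I \<in> \<I> \<Longrightarrow> is_interval I" "U = \<Union>\<I>"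
    using assms unfolding finite_union_of_intervals_def by blast
  have "negligible (\<Union>(frontier ` \<I>))"
    using I(1,2) by (intro negligible_Union)
      (auto intro: negligible_convex_frontier is_interval_convex)
  then show ?thesis
    using frontier_Union_subset[OF I(1)] I(3) by (metis negligible_subset)
qed

theorem theorem6:
  fixes U :: "real set"
  assumes "hopf_set U" and "finite_union_of_intervals U"
  shows "\<exists>U'. maximal_hopf_set U' \<and> U \<subseteq> U'"
  using hopf_set_negligible_frontier_extends_to_maximal hopf_set_interior_symmetrization(2)
    negligible_frontier_finite_union_of_intervals assms by blast

end
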